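(* (i) Up to an arbitrary generic constant $C$ free of $A$, the adjustment factors $h_{i;\mathrm{gls}}(A)$ and $h_{i;\mathrm{ols}}(A)$, i.e. the solutions $h_i(A)$ of the differential equation $a_i+b_i[h_i(A)]=0$ for the GLS and OLS estimators of $\beta$ respectively (see context), are $$h_{i;\mathrm{gls}}(A)=C\,A^{\frac14(1+z^2)}(A+D_i)^{\frac14(7-z^2)}\exp\left[\int\tfrac12\operatorname{tr}(V^{-2})\,x_i'(X'V^{-1}X)^{-1}x_i\,dA\right],$$ $$h_{i;\mathrm{ols}}(A)=C\,A^{\frac14(1+z^2)}(A+D_i)^{\frac14(7-z^2)}\left[\prod_{k=1}^m(A+D_k)\right]^{\frac12q_i}\exp\left[-\tfrac12\operatorname{tr}(V^{-1})\,x_i'(X'X)^{-1}X'VX(X'X)^{-1}x_i\right],$$ where $\int\cdot\,dA$ denotes an antiderivative in $A$. (ii) In the balanced case $D_i=D$ ($i=1,\dots,m$), $$h_{i;\mathrm{gls}}(A)=h_{i;\mathrm{ols}}(A)=C\,A^{\frac14(1+z^2)}(A+D)^{\frac14(7-z^2)+\frac12mq_i}.$$ In this balanced case, the corresponding adjusted residual maximum likelihood estimator $\hat A_i=\hat A_{i;\mathrm{gls}}=\hat A_{i;\mathrm{ols}}$ is unique provided $m>\frac{4+p}{1-q_i}$.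
   Context: Fay–Herriot model: for $i=1,\dots,m$, $y_i=x_i'\beta+v_i+e_i$, with mutually independent $v_i\sim N(0,A)$, $e_i\sim N(0,D_i)$; $x_i\in\mathbb R^p$ ($p<m$) and $D_i>0$ known; $\beta\in\mathbb R^p$ and $A$ unknown. Notation: $y=(y_1,\dots,y_m)'$; $X'=(x_1,\dots,x_m)$, with $X$ an $m\times p$ matrix of rank $p$; $q_i=x_i'(X'X)^{-1}x_i$; $V=\operatorname{diag}(A+D_1,\dots,A+D_m)$ (a function of $A$); $P=V^{-1}-V^{-1}X(X'V^{-1}X)^{-1}X'V^{-1}$; $z=z_{\alpha/2}$ is the normal quantile with $\Phi(z)=1-\alpha/2$. The residual likelihood is $L_{\mathrm{RE}}(A)=|X'V^{-1}X|^{-1/2}|V|^{-1/2}\exp(-\tfrac12y'Py)$. For a (positive, differentiable on $(0,\infty)$) adjustment factor $h_i(A)$ put $$a_i=-\frac{m}{\operatorname{tr}(V^{-2})}\left[\frac{4D_i}{A(A+D_i)^2}+\frac{(1+z^2)D_i^2}{2A^2(A+D_i)^2}\right]-\frac{mD_i}{A(A+D_i)}x_i'\operatorname{Var}(\tilde\beta)x_i,$$ $$b_i[h_i(A)]=\frac{2m}{\operatorname{tr}(V^{-2})}\frac{D_i}{A(A+D_i)}\frac{d}{dA}\log h_i(A),$$ where $\operatorname{Var}(\tilde\beta)=(X'V^{-1}X)^{-1}$ in the GLS case ($\tilde\beta=(X'V^{-1}X)^{-1}X'V^{-1}y$) and $\operatorname{Var}(\tilde\beta)=(X'X)^{-1}X'VX(X'X)^{-1}$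 in the OLS case ($\tilde\beta=(X'X)^{-1}X'y$). The functions $h_{i;\mathrm{gls}}$ and $h_{i;\mathrm{ols}}$ are the solutions $h_i$ of $a_i+b_i[h_i(A)]=0$ (as an equation in $A>0$) in the GLS and OLS cases, respectively. The adjusted residual maximum likelihood estimators are $\hat A_{i;h}=\arg\max_{A\in[0,\infty)}h_{i;h}(A)L_{\mathrm{RE}}(A)$ for $h=\mathrm{gls},\mathrm{ols}$. *)

theory Defs
  imports "HOL-Probability.Probability"
begin

text \<open>
  The type \<open>'m\<close> indexes the \<open>m\<close> areas and \<open>'p\<close> the \<open>p\<close> covariates, so that the design matrix \<open>X\<close>
  has type \<open>real^'p^'m\<close> and its row \<open>X $ i\<close> is the covariate vector \<open>x\<^sub>i\<close>.
\<close>

definition fh_V :: "real^'m \<Rightarrow> real \<Rightarrow> real^'m^'m" where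
  "fh_V D A = (\<chi> i j. if i = j then A + D $ i else 0)"

definition fh_P :: "real^'p^'m \<Rightarrow> real^'m \<Rightarrow> real \<Rightarrow> real^'m^'m" where
  "fh_P X D A =
     (let W = matrix_inv (fh_V D A)
      in W - W ** X ** matrix_inv (transpose X ** W ** X) ** transpose X ** W)"

definition leverage :: "real^'p^'m \<Rightarrow> 'm \<Rightarrow> real" where
  "leverage X i = X $ i \<bullet> (matrix_inv (transpose X ** X) *v X $ i)"

text \<open>Sampling covariance matrices of the GLS and OLS estimators of \<open>\<beta>\<close>, as functions of \<open>A\<close>.\<close>

definition var_gls :: "real^'p^'m \<Rightarrow> real^'m \<Rightarrow> real \<Rightarrow> real^'p^'p" where
  "var_gls X D A = matrix_inv (transpose X ** matrix_inv (fh_V D A) ** X)"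

definition var_ols :: "real^'p^'m \<Rightarrow> real^'m \<Rightarrow> real \<Rightarrow> real^'p^'p" where
  "var_ols X D A =
     matrix_inv (transpose X ** X) ** transpose X ** fh_V D A ** X ** matrix_inv (transpose X ** X)"

definition tr_Vinv :: "real^'m \<Rightarrow> real \<Rightarrow> real" where
  "tr_Vinv D A = trace (matrix_inv (fh_V D A))"

definition tr_Vinv2 :: "real^'m \<Rightarrow> real \<Rightarrow> real" where
  "tr_Vinv2 D A = trace (matrix_inv (fh_V D A) ** matrix_inv (fh_V D A))"

definition residual_likelihood :: "real^'p^'m \<Rightarrow> real^'m \<Rightarrow> real^'m \<Rightarrow> real \<Rightarrow> real" where
  "residual_likelihood X D y A =
     det (transpose X ** matrix_inv (fh_V D A) ** X) powr (- (1/2))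
     * det (fh_V D A) powr (- (1/2))
     * exp (- (1/2) * (y \<bullet> (fh_P X D A *v y)))"

text \<open>The terms \<open>a\<^sub>i\<close> and \<open>b\<^sub>i\<close>; the argument \<open>S\<close> is the covariance matrix of the estimator of \<open>\<beta>\<close>.\<close>

definition adj_a ::
  "real^'p^'m \<Rightarrow> real^'m \<Rightarrow> real \<Rightarrow> (real \<Rightarrow> real^'p^'p) \<Rightarrow> 'm \<Rightarrow> real \<Rightarrow> real" where
  "adj_a X D z S i A =
     - (real CARD('m) / tr_Vinv2 D A)
         * (4 * D $ i / (A * (A + D $ i)^2)
            + (1 + z^2) * (D $ i)^2 / (2 * A^2 * (A + D $ i)^2))
     - real CARD('m) * D $ i / (A * (A + D $ i)) * (X $ i \<bullet> (S A *v X $ i))"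

definition adj_b :: "real^'m \<Rightarrow> 'm \<Rightarrow> (real \<Rightarrow> real) \<Rightarrow> real \<Rightarrow> real" where
  "adj_b D i h A =
     2 * real CARD('m) / tr_Vinv2 D A * (D $ i / (A * (A + D $ i))) * deriv (\<lambda>t. ln (h t)) A"

text \<open>
  Positive differentiable solutions \<open>h\<close> on \<open>(0, \<infinity>)\<close> of \<open>a\<^sub>i + b\<^sub>i[h] = 0\<close>; nothing is
  said about \<open>h\<close> outside \<open>(0, \<infinity>)\<close>.
\<close>

definition is_adjustment_factor ::
  "real^'p^'m \<Rightarrow> real^'m \<Rightarrow> real \<Rightarrow> (real \<Rightarrow> real^'p^'p) \<Rightarrow> 'm \<Rightarrow> (real \<Rightarrow> real) \<Rightarrow> bool" where
  "is_adjustment_factor X D z S i h \<longleftrightarrow>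
     (\<forall>A>0. h A > 0 \<and> h differentiable (at A) \<and> adj_a X D z S i A + adj_b D i h A = 0)"

abbreviation is_h_gls :: "real^'p^'m \<Rightarrow> real^'m \<Rightarrow> real \<Rightarrow> 'm \<Rightarrow> (real \<Rightarrow> real) \<Rightarrow> bool" where
  "is_h_gls X D z \<equiv> is_adjustment_factor X D z (var_gls X D)"

abbreviation is_h_ols :: "real^'p^'m \<Rightarrow> real^'m \<Rightarrow> real \<Rightarrow> 'm \<Rightarrow> (real \<Rightarrow> real) \<Rightarrow> bool" where
  "is_h_ols X D z \<equiv> is_adjustment_factor X D z (var_ols X D)"

text \<open>The set of all adjusted residual maximum likelihood estimates of \<open>A\<close> for the data \<open>y\<close>.\<close>

definition adj_reml_estimates ::
  "real^'p^'m \<Rightarrow> real^'m \<Rightarrow> (real \<Rightarrow> real) \<Rightarrow> real^'m \<Rightarrow> real set" where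
  "adj_reml_estimates X D h y =
     {A. is_arg_max (\<lambda>t. h t * residual_likelihood X D y t) (\<lambda>t. t \<in> {0..}) A}"

end

theory Submission
  imports Defs
begin

text \<open>
  The common factor \<open>2m/tr(V\<^sup>-\<^sup>2) \<cdot> D\<^sub>i/(A(A + D\<^sub>i))\<close> of \<open>a\<^sub>i\<close> and \<open>b\<^sub>i\<close> is positive. Dividing by
  it turns \<open>a\<^sub>i + b\<^sub>i[h] = 0\<close> into a prescription of the logarithmic derivative of \<open>h\<close>,
  \<open>(log h)' = (1 + z\<^sup>2)/(4A) + (7 - z\<^sup>2)/(4(A + D\<^sub>i)) + tr(V\<^sup>-\<^sup>2) x\<^sub>i'Var(\<beta>)x\<^sub>i / 2\<close>
  (\<open>adjustment_equation_iff\<close>). The first two summands integrate to the two powers, so everything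
  depends on an antiderivative \<open>G\<close> of the third, and the constant of integration becomes the factor
  \<open>C > 0\<close> (\<open>adjustment_factor_iff\<close>).

  For GLS an antiderivative exists because the integrand is continuous: \<open>X'V\<^sup>-\<^sup>1X\<close> is
  invertible for a design of full column rank, and Cramer's rule gives continuity of its inverse.
  For OLS the quadratic form \<open>q(A) = x\<^sub>i'Var(\<beta>)x\<^sub>i\<close> is affine in \<open>A\<close> with slope the
  leverage \<open>q\<^sub>i\<close>, and \<open>tr(V\<^sup>-\<^sup>2) = - (tr V\<^sup>-\<^sup>1)'\<close>. Integration by parts therefore yields
  \<open>G = q\<^sub>i/2 \<cdot> log \<Prod>(A + D\<^sub>k) - tr(V\<^sup>-\<^sup>1) q(A)/2\<close> (\<open>h_ols_iff\<close>).

  In the balanced case \<open>V = (A + d)I\<close>, the GLS and OLS covariances both equal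
  \<open>(A + d)(X'X)\<^sup>-\<^sup>1\<close>, and the objective \<open>h L\<close> is a positive multiple of
  \<open>A\<^sup>a (A + d)\<^sup>c exp(- s/(2(A + d)))\<close> with \<open>a = (1 + z\<^sup>2)/4 > 0\<close> and
  \<open>a + c = (4 + p - m(1 - q\<^sub>i))/2\<close>. The condition on \<open>m\<close> says exactly that \<open>a + c < 0\<close> when \<open>q\<^sub>i < 1\<close>.
  After multiplication by \<open>A(A + d)\<^sup>2\<close> the logarithmic derivative is a quadratic polynomial
  with negative leading coefficient \<open>a + c\<close> and positive value \<open>a d\<^sup>2\<close> at \<open>0\<close>. It
  has one positive root, with a sign change from plus to minus, so the objective has one peak
  (\<open>balanced_profile_unique_peak\<close>). At \<open>A = 0\<close> the objective vanishes by continuity of \<open>h\<close>, so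
  the boundary does not compete.
\<close>

section \<open>Matrices with a diagonal factor\<close>

definition diagonal_matrix :: "('n \<Rightarrow> real) \<Rightarrow> real^'n^'n" where
  "diagonal_matrix w = (\<chi> i j. if i = j then w i else 0)"

lemma diagonal_matrix_mult:
  "diagonal_matrix v ** diagonal_matrix w = diagonal_matrix (\<lambda>i. v i * w i)"
  by (auto simp: diagonal_matrix_def matrix_matrix_mult_def vec_eq_iff
      if_distrib[where f="\<lambda>x. x * y" for y] cong: if_cong)

lemma diagonal_matrix_vector_mult: "(diagonal_matrix w *v x) $ i = w i * x $ i"
  by (simp add: diagonal_matrix_def matrix_vector_mult_def
      if_distrib[where f="\<lambda>x. x * y" for y] cong: if_cong)

lemma trace_diagonal_matrix: "trace (diagonal_matrix w) = (\<Sum>i\<in>UNIV. w i)"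
  by (simp add: diagonal_matrix_def trace_def)

lemma det_diagonal_matrix: "det (diagonal_matrix w) = (\<Prod>i\<in>UNIV. w i)"
  by (subst det_diagonal) (auto simp: diagonal_matrix_def)

lemma diagonal_matrix_const: "diagonal_matrix (\<lambda>_. c) = c *\<^sub>R mat 1"
  by (simp add: diagonal_matrix_def mat_def vec_eq_iff)

lemma matrix_inv_eqI:
  fixes M N :: "real^'n^'n"
  assumes "M ** N = mat 1"
  shows "matrix_inv M = N"
proof -
  have "N ** M = mat 1"
    using assms by (subst matrix_left_right_inverse) simp
  then have "M ** matrix_inv M = mat 1 \<and> matrix_inv M ** M = mat 1"
    using assms someI[of "\<lambda>N. M ** N = mat 1 \<and> N ** M = mat 1" N]
    by (simp add: matrix_inv_def)
  then have "N ** (M ** matrix_inv M) = N"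
    by simp
  then show ?thesis
    by (simp add: matrix_mul_assoc \<open>N ** M = mat 1\<close>)
qed

lemma matrix_inv_right:
  fixes M :: "real^'n^'n"
  assumes "invertible M"
  shows "M ** matrix_inv M = mat 1"
proof -
  obtain N where "M ** N = mat 1"
    using assms by (auto simp: invertible_def)
  then show ?thesis
    using matrix_inv_eqI[of M N] by simp
qed

lemma matrix_inv_scaleR:
  fixes M :: "real^'n^'n"
  assumes "c \<noteq> 0" "invertible M"
  shows "matrix_inv (c *\<^sub>R M) = (1 / c) *\<^sub>R matrix_inv M"
  by (rule matrix_inv_eqI)
    (use assms in \<open>simp add: matrix_scalar_ac matrix_inv_right flip: scalar_matrix_assoc\<close>)

lemma det_scaleR:
  fixes M :: "real^'n^'n"
  shows "det (c *\<^sub>R M) = c ^ CARD('n) * det M"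
proof -
  have "c *\<^sub>R M = diagonal_matrix (\<lambda>_. c) ** M"
    by (simp add: diagonal_matrix_const flip: scalar_matrix_assoc)
  then show ?thesis
    by (simp add: det_mul det_diagonal_matrix)
qed

lemma matrix_inv_diagonal_matrix:
  assumes "\<And>i. w i \<noteq> 0"
  shows "matrix_inv (diagonal_matrix w) = diagonal_matrix (\<lambda>i. 1 / w i)"
  by (rule matrix_inv_eqI) (use assms in \<open>simp add: diagonal_matrix_mult diagonal_matrix_const\<close>)

text \<open>With positive weights the quadratic form of the weighted Gram matrix is
  \<open>\<Sum>\<^sub>k w\<^sub>k (X u)\<^sub>k\<^sup>2\<close>, so a kernel vector \<open>u\<close> is annihilated by \<open>X\<close> itself,
  which has full column rank.\<close>

lemma invertible_weighted_gram:
  fixes X :: "real^'p^'m"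
  assumes "rank X = CARD('p)" and w: "\<And>i. w i > 0"
  shows "invertible (transpose X ** diagonal_matrix w ** X)"
proof -
  have "u = 0" if "(transpose X ** diagonal_matrix w ** X) *v u = 0" for u
  proof -
    have "0 = u \<bullet> (transpose X *v (diagonal_matrix w *v (X *v u)))"
      using that by (simp only: matrix_vector_mul_assoc matrix_mul_assoc inner_zero_right)
    also have "\<dots> = (X *v u) \<bullet> (diagonal_matrix w *v (X *v u))"
      by (metis dot_lmul_matrix inner_commute transpose_matrix_vector)
    also have "\<dots> = (\<Sum>k\<in>UNIV. w k * ((X *v u) $ k)\<^sup>2)"
      by (simp add: inner_vec_def diagonal_matrix_vector_mult power2_eq_square mult.left_commute)
    finally have "(\<Sum>k\<in>UNIV. w k * ((X *v u) $ k)\<^sup>2) = 0" by simp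
    then have "\<forall>k. w k * ((X *v u) $ k)\<^sup>2 = 0"
      by (subst (asm) sum_nonneg_eq_0_iff) (auto simp: w less_imp_le)
    then have "X *v u = 0"
      using less_imp_neq[OF w] by (simp add: vec_eq_iff)
    then show "u = 0"
      using assms(1) full_rank_injective[of X] by (metis injD matrix_vector_mult_0_right)
  qed
  then show ?thesis
    by (metis invertible_left_inverse matrix_left_invertible_ker)
qed

corollary invertible_gram:
  fixes X :: "real^'p^'m"
  assumes "rank X = CARD('p)"
  shows "invertible (transpose X ** X)"
  using invertible_weighted_gram[OF assms, of "\<lambda>_. 1"] by (simp add: diagonal_matrix_const)

lemma continuous_on_det:
  fixes M :: "real \<Rightarrow> real^'n^'n"
  assumes "\<And>i j. continuous_on S (\<lambda>t. M t $ i $ j)"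
  shows "continuous_on S (\<lambda>t. det (M t))"
  unfolding det_def by (intro continuous_intros assms)

text \<open>Cramer's rule makes the entries of the inverse quotients of determinants, hence of
  polynomials in the entries of the matrix.\<close>

lemma continuous_on_matrix_inv_vector:
  fixes M :: "real \<Rightarrow> real^'n^'n"
  assumes M: "\<And>i j. continuous_on S (\<lambda>t. M t $ i $ j)"
    and inv: "\<And>t. t \<in> S \<Longrightarrow> invertible (M t)"
  shows "continuous_on S (\<lambda>t. matrix_inv (M t) *v b)"
proof -
  let ?N = "\<lambda>t k. (\<chi> i j. if j = k then b $ i else M t $ i $ j) :: real^'n^'n"
  have "matrix_inv (M t) *v b = (\<chi> k. det (?N t k) / det (M t))" if "t \<in> S" for t
    using cramer[of "M t" "matrix_inv (M t) *v b" b] inv[OF that]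
    by (simp add: invertible_det_nz matrix_vector_mul_assoc matrix_inv_right)
  moreover have "continuous_on S (\<lambda>t. \<chi> k. det (?N t k) / det (M t))"
  proof (intro continuous_on_vec_lambda continuous_on_divide continuous_on_det M)
    show "continuous_on S (\<lambda>t. ?N t k $ i $ j)" for k i j
      by (cases "j = k") (simp_all add: M)
    show "\<forall>t\<in>S. det (M t) \<noteq> 0"
      using inv by (simp add: invertible_det_nz)
  qed
  ultimately show ?thesis
    by (simp cong: continuous_on_cong)
qed

section \<open>The Fay--Herriot matrices\<close>

lemma fh_V_eq: "fh_V D A = diagonal_matrix (\<lambda>j. A + D $ j)"
  by (simp add: fh_V_def diagonal_matrix_def)

lemma fh_V_inverse:
  assumes "\<And>j. A + D $ j > 0"
  shows "matrix_inv (fh_V D A) = diagonal_matrix (\<lambda>j. 1 / (A + D $ j))"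
  unfolding fh_V_eq using assms by (intro matrix_inv_diagonal_matrix) (metis less_irrefl)

lemma tr_Vinv_eq:
  assumes "\<And>j. A + D $ j > 0"
  shows "tr_Vinv D A = (\<Sum>j\<in>UNIV. 1 / (A + D $ j))"
  by (simp add: tr_Vinv_def fh_V_inverse[OF assms] trace_diagonal_matrix)

lemma tr_Vinv2_eq:
  assumes "\<And>j. A + D $ j > 0"
  shows "tr_Vinv2 D A = (\<Sum>j\<in>UNIV. 1 / (A + D $ j)\<^sup>2)"
  by (simp add: tr_Vinv2_def fh_V_inverse[OF assms] trace_diagonal_matrix diagonal_matrix_mult
      power2_eq_square)

lemma tr_Vinv2_pos:
  assumes "\<And>j. A + D $ j > 0"
  shows "tr_Vinv2 D A > 0"
  unfolding tr_Vinv2_eq[OF assms] using assms by (intro sum_pos) (auto, metis less_irrefl)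

lemma has_real_derivative_tr_Vinv:
  fixes D :: "real^'m"
  assumes D: "\<And>j. D $ j > 0" and A: "A > 0"
  shows "(tr_Vinv D has_real_derivative - tr_Vinv2 D A) (at A)"
proof -
  have pos: "t + D $ j > 0" if "t > 0" for t j
    using D[of j] that by simp
  have nz: "A + D $ j \<noteq> 0" for j
    using pos[OF A, of j] by simp
  have "((\<lambda>t. \<Sum>j\<in>UNIV. 1 / (t + D $ j)) has_real_derivative
      (\<Sum>j\<in>UNIV. - (1 / (A + D $ j)\<^sup>2))) (at A)"
    by (auto intro!: derivative_eq_intros sum.cong simp: nz power2_eq_square)
  then have "(tr_Vinv D has_real_derivative (\<Sum>j\<in>UNIV. - (1 / (A + D $ j)\<^sup>2))) (at A)"
    by (rule has_field_derivative_transform_within_open[where S="{0<..}"])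
       (use A pos in \<open>auto simp: tr_Vinv_eq\<close>)
  then show ?thesis
    by (simp add: tr_Vinv2_eq pos A sum_negf)
qed

lemma gram_inverse_sandwich:
  fixes X :: "real^'p^'m"
  assumes "rank X = CARD('p)"
  shows "matrix_inv (transpose X ** X) ** transpose X ** X ** matrix_inv (transpose X ** X)
    = matrix_inv (transpose X ** X)"
  using matrix_inv_right[OF invertible_gram[OF assms]] by (metis matrix_mul_assoc matrix_mul_rid)

text \<open>OLS does not weight by \<open>V\<close>, so its covariance depends linearly on \<open>V\<close>; and
  \<open>V = A I + diag(D)\<close>. The part proportional to \<open>A\<close> collapses to \<open>(X'X)\<^sup>-\<^sup>1\<close>,
  which makes the leverage the slope of the quadratic form.\<close>

lemma var_ols_affine:
  fixes X :: "real^'p^'m"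
  assumes "rank X = CARD('p)"
  shows "var_ols X D A = A *\<^sub>R matrix_inv (transpose X ** X) + var_ols X D 0"
proof -
  have V: "fh_V D A = A *\<^sub>R mat 1 + fh_V D 0"
    by (simp add: fh_V_def mat_def vec_eq_iff)
  note B = gram_inverse_sandwich[OF assms]
  have distrib: "(M + N) ** K = M ** K + N ** K" for M N :: "real^'b^'a" and K :: "real^'c^'b"
    by (simp add: matrix_matrix_mult_def vec_eq_iff sum.distrib algebra_simps)
  show ?thesis
    unfolding var_ols_def V
    by (simp add: matrix_add_ldistrib distrib matrix_scalar_ac B flip: scalar_matrix_assoc)
qed

lemma has_real_derivative_var_ols_form:
  fixes X :: "real^'p^'m"
  assumes "rank X = CARD('p)"
  shows "((\<lambda>A. X $ i \<bullet> (var_ols X D A *v X $ i)) has_real_derivative leverage X i) (at A)"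
proof -
  have "(\<lambda>A. X $ i \<bullet> (var_ols X D A *v X $ i))
      = (\<lambda>A. A * leverage X i + X $ i \<bullet> (var_ols X D 0 *v X $ i))"
    by (rule ext, subst var_ols_affine[OF assms])
      (simp add: matrix_vector_mult_add_rdistrib inner_add_right leverage_def
        flip: scaleR_matrix_vector_assoc)
  then show ?thesis
    by (auto intro!: derivative_eq_intros)
qed

lemma continuous_on_var_gls_form:
  fixes X :: "real^'p^'m"
  assumes rank: "rank X = CARD('p)" and D: "\<And>j. D $ j > 0"
  shows "continuous_on {0<..} (\<lambda>A. X $ i \<bullet> (var_gls X D A *v X $ i))"
proof -
  let ?W = "\<lambda>A. diagonal_matrix (\<lambda>j. 1 / (A + D $ j))"
  have pos: "A + D $ j > 0" if "A \<in> {0<..}" for A j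
    using D[of j] that by simp
  have nz: "A + D $ j \<noteq> 0" if "A > 0" for A j
    using pos[of A j] that by simp
  have "continuous_on {0<..} (\<lambda>A. matrix_inv (transpose X ** ?W A ** X) *v X $ i)"
  proof (rule continuous_on_matrix_inv_vector)
    fix k l
    have W: "continuous_on {0<..} (\<lambda>A. ?W A $ r $ s)" for r s
      by (cases "r = s") (auto simp: diagonal_matrix_def nz intro!: continuous_intros)
    show "continuous_on {0<..} (\<lambda>A. (transpose X ** ?W A ** X) $ k $ l)"
      unfolding matrix_matrix_mult_def vec_lambda_beta
      by (intro continuous_on_sum continuous_on_mult continuous_on_const W)
    show "invertible (transpose X ** ?W A ** X)" if "A \<in> {0<..}" for A
      using pos[OF that] by (intro invertible_weighted_gram rank) simp
  qed
  then have "continuous_on {0<..} (\<lambda>A. X $ i \<bullet> (matrix_inv (transpose X ** ?W A ** X) *v X $ i))"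
    by (intro continuous_intros)
  then show ?thesis
    by (rule continuous_on_eq) (simp add: var_gls_def fh_V_inverse pos)
qed

text \<open>For unequal \<open>D\<^sub>k\<close> the antiderivative is left unevaluated; the fundamental theorem of
  calculus provides one on all of \<open>(0, \<infinity>)\<close> at once, where the integrand is continuous.\<close>

lemma var_gls_antiderivative_exists:
  fixes X :: "real^'p^'m"
  assumes rank: "rank X = CARD('p)" and D: "\<And>j. D $ j > 0"
  shows "\<exists>G. \<forall>A>0. (G has_real_derivative
           1/2 * tr_Vinv2 D A * (X $ i \<bullet> (var_gls X D A *v X $ i))) (at A)"
proof -
  let ?g = "\<lambda>A. 1/2 * tr_Vinv2 D A * (X $ i \<bullet> (var_gls X D A *v X $ i))"
  have pos: "A + D $ j > 0" if "A \<in> {0<..}" for A j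
    using D[of j] that by simp
  have "continuous_on {0<..} (\<lambda>A. \<Sum>j\<in>UNIV. 1 / (A + D $ j)\<^sup>2)"
    by (intro continuous_intros) (use pos in \<open>auto simp: less_imp_neq[symmetric]\<close>)
  then have "continuous_on {0<..} (tr_Vinv2 D)"
    by (rule continuous_on_eq) (simp add: tr_Vinv2_eq pos)
  then have "continuous_on {0<..} ?g"
    by (intro continuous_intros continuous_on_var_gls_form assms)
  then have "isCont ?g A" if "0 < ereal A" for A
    using that by (simp add: continuous_on_eq_continuous_at)
  then show ?thesis
    using einterval_antiderivative[of 0 \<infinity> ?g]
    by (auto simp: has_real_derivative_iff_has_vector_derivative)
qed

section \<open>The differential equation for the adjustment factor\<close>

text \<open>If \<open>F\<close> is an antiderivative of the prescribed logarithmic derivative, then \<open>log h - F\<close> has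
  derivative \<open>0\<close> on the interval \<open>(0, \<infinity>)\<close> and is therefore constant there. The values of \<open>h\<close> on
  \<open>(-\<infinity>, 0]\<close> stay arbitrary on both sides of the equivalence.\<close>

lemma log_derivative_solution_iff:
  fixes F \<phi> h :: "real \<Rightarrow> real"
  assumes F: "\<And>A. A > 0 \<Longrightarrow> (F has_real_derivative \<phi> A) (at A)"
  shows "(\<forall>A>0. h A > 0 \<and> h differentiable (at A) \<and> deriv (\<lambda>t. ln (h t)) A = \<phi> A)
     \<longleftrightarrow> (\<exists>C>0. \<forall>A>0. h A = C * exp (F A))" (is "?sol \<longleftrightarrow> ?form")
proof
  assume sol: ?sol
  have "((\<lambda>t. ln (h t) - F t) has_real_derivative 0) (at A)" if "A > 0" for A
  proof -
    have h: "h A > 0" "deriv (\<lambda>t. ln (h t)) A = \<phi> A"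
      and "(h has_real_derivative deriv h A) (at A)"
      using sol that by (simp_all add: DERIV_deriv_iff_real_differentiable)
    then have "((\<lambda>t. ln (h t)) has_real_derivative 1 / h A * deriv h A) (at A)"
      by (intro DERIV_chain2[OF DERIV_ln_divide])
    with DERIV_imp_deriv[OF this] have "((\<lambda>t. ln (h t)) has_real_derivative \<phi> A) (at A)"
      by (simp only: h)
    from DERIV_diff[OF this F[OF that]] show ?thesis by simp
  qed
  then have "\<exists>c. \<forall>A\<in>{0<..}. ln (h A) - F A = c"
    by (intro has_field_derivative_zero_constant)
      (auto intro: has_field_derivative_at_within)
  then obtain c where c: "\<And>A. A > 0 \<Longrightarrow> ln (h A) = c + F A"
    by (auto simp: algebra_simps)
  have "h A = exp c * exp (F A)" if "A > 0" for A
    using sol c[OF that] that by (metis exp_add exp_ln)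
  then show ?form
    by (intro exI[of _ "exp c"]) simp
next
  assume ?form
  then obtain C where C: "C > 0" and h: "\<And>A. A > 0 \<Longrightarrow> h A = C * exp (F A)" by blast
  show ?sol
  proof (intro allI impI conjI)
    fix A :: real assume A: "A > 0"
    show "h A > 0" using C h[OF A] by simp
    have "((\<lambda>t. C * exp (F t)) has_real_derivative C * (exp (F A) * \<phi> A)) (at A)"
      by (auto intro!: derivative_eq_intros F[OF A])
    then have "(h has_real_derivative C * (exp (F A) * \<phi> A)) (at A)"
      by (rule has_field_derivative_transform_within_open[where S="{0<..}"]) (use A h in auto)
    then show "h differentiable (at A)"
      using real_differentiable_def by blast
    have "((\<lambda>t. ln C + F t) has_real_derivative \<phi> A) (at A)"
      by (auto intro!: derivative_eq_intros F[OF A])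
    then have "((\<lambda>t. ln (h t)) has_real_derivative \<phi> A) (at A)"
      by (rule has_field_derivative_transform_within_open[where S="{0<..}"])
        (use A C in \<open>auto simp: h ln_mult\<close>)
    then show "deriv (\<lambda>t. ln (h t)) A = \<phi> A"
      by (rule DERIV_imp_deriv)
  qed
qed

text \<open>After division by the common factor of \<open>a\<^sub>i\<close> and \<open>b\<^sub>i\<close> the bracket in \<open>a\<^sub>i\<close> is, up to sign,
  \<open>2/(A + D\<^sub>i) + (1 + z\<^sup>2)/4 \<cdot> D\<^sub>i/(A(A + D\<^sub>i))\<close>, whose partial fractions have
  the coefficients \<open>(1 + z\<^sup>2)/4\<close> and \<open>2 - (1 + z\<^sup>2)/4 = (7 - z\<^sup>2)/4\<close>. These become the
  two exponents in the adjustment factor.\<close>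

lemma adjustment_equation_iff:
  fixes X :: "real^'p^'m"
  assumes D: "\<And>j. D $ j > 0" and A: "A > 0"
  shows "adj_a X D z S i A + adj_b D i h A = 0 \<longleftrightarrow>
    deriv (\<lambda>t. ln (h t)) A = 1/4 * (1 + z\<^sup>2) / A + 1/4 * (7 - z\<^sup>2) / (A + D $ i)
      + 1/2 * tr_Vinv2 D A * (X $ i \<bullet> (S A *v X $ i))"
proof -
  define d T q L m where "d = D $ i" and "T = tr_Vinv2 D A" and "q = X $ i \<bullet> (S A *v X $ i)"
    and "L = deriv (\<lambda>t. ln (h t)) A" and "m = real CARD('m)"
  let ?\<phi> = "1/4 * (1 + z\<^sup>2) / A + 1/4 * (7 - z\<^sup>2) / (A + d) + 1/2 * T * q"
  have "A + D $ j > 0" for j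
    using D[of j] A by simp
  then have T: "T > 0" unfolding T_def by (rule tr_Vinv2_pos)
  have d: "d > 0" "A + d > 0" "m > 0" using D A by (auto simp: d_def m_def add_pos_pos)
  define k where "k = 2 * m / T * (d / (A * (A + d)))"
  have k: "k > 0" using T A d by (simp add: k_def)
  have bracket: "4 * d / (A * (A + d)\<^sup>2) + (1 + z\<^sup>2) * d\<^sup>2 / (2 * A\<^sup>2 * (A + d)\<^sup>2)
      = 2 * (d / (A * (A + d))) * (1/4 * (1 + z\<^sup>2) / A + 1/4 * (7 - z\<^sup>2) / (A + d))"
    using A d by (simp add: divide_simps) (simp add: algebra_simps power2_eq_square)
  have "m * d / (A * (A + d)) = k * (1/2 * T)"
    using T by (simp add: k_def)
  moreover have "m / T * (2 * (d / (A * (A + d))) * r) = k * r" for r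
    by (simp add: k_def)
  ultimately have a: "adj_a X D z S i A = - (k * ?\<phi>)"
    unfolding adj_a_def d_def[symmetric] T_def[symmetric] q_def[symmetric] m_def[symmetric] bracket
    by (simp only: mult_minus_left) (simp only: distrib_left mult.assoc)
  have b: "adj_b D i h A = k * L"
    by (simp add: adj_b_def k_def d_def T_def L_def m_def)
  have "adj_a X D z S i A + adj_b D i h A = k * (L - ?\<phi>)"
    unfolding a b by (simp only: right_diff_distrib)
  then show ?thesis
    using k by (simp flip: d_def T_def q_def L_def)
qed

lemma positive_multiple_cong:
  fixes f g h :: "real \<Rightarrow> real"
  assumes "\<And>A. A > 0 \<Longrightarrow> f A = g A"
  shows "(\<exists>C>0. \<forall>A>0. h A = C * f A) \<longleftrightarrow> (\<exists>C>0. \<forall>A>0. h A = C * g A)"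
  using assms by simp

text \<open>GLS and OLS differ only through the covariance \<open>S\<close>, so both are instances of this statement,
  with different antiderivatives \<open>G\<close>.\<close>

lemma adjustment_factor_iff:
  fixes X :: "real^'p^'m"
  assumes D: "\<And>j. D $ j > 0"
    and G: "\<And>A. A > 0 \<Longrightarrow>
      (G has_real_derivative 1/2 * tr_Vinv2 D A * (X $ i \<bullet> (S A *v X $ i))) (at A)"
  shows "is_adjustment_factor X D z S i h \<longleftrightarrow>
    (\<exists>C>0. \<forall>A>0. h A = C * A powr (1/4 * (1 + z\<^sup>2)) * (A + D $ i) powr (1/4 * (7 - z\<^sup>2)) * exp (G A))"
proof -
  define a b where "a = 1/4 * (1 + z\<^sup>2)" and "b = 1/4 * (7 - z\<^sup>2)"
  let ?F = "\<lambda>A. a * ln A + b * ln (A + D $ i) + G A"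
  let ?\<phi> = "\<lambda>A. a / A + b / (A + D $ i) + 1/2 * tr_Vinv2 D A * (X $ i \<bullet> (S A *v X $ i))"
  have pos: "A + D $ i > 0" if "A > 0" for A
    using D[of i] that by simp
  have "(?F has_real_derivative ?\<phi> A) (at A)" if "A > 0" for A
    using that pos[OF that] G[OF that] by (auto intro!: derivative_eq_intros simp: field_simps)
  note solution = log_derivative_solution_iff[OF this]
  have "is_adjustment_factor X D z S i h \<longleftrightarrow>
    (\<forall>A>0. h A > 0 \<and> h differentiable (at A) \<and> deriv (\<lambda>t. ln (h t)) A = ?\<phi> A)"
    unfolding is_adjustment_factor_def a_def b_def using adjustment_equation_iff[OF D] by blast
  also have "\<dots> \<longleftrightarrow> (\<exists>C>0. \<forall>A>0. h A = C * exp (?F A))"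
    by (rule solution)
  also have "\<dots> \<longleftrightarrow> (\<exists>C>0. \<forall>A>0. h A = C * (A powr a * (A + D $ i) powr b * exp (G A)))"
  proof (rule positive_multiple_cong)
    fix A :: real assume "A > 0"
    then show "exp (?F A) = A powr a * (A + D $ i) powr b * exp (G A)"
      using pos[of A] by (simp add: exp_add powr_def)
  qed
  finally show ?thesis
    by (simp only: a_def b_def mult.assoc)
qed

text \<open>By the product rule, \<open>(- tr(V\<^sup>-\<^sup>1) q(A)/2)' = tr(V\<^sup>-\<^sup>2) q(A)/2 - tr(V\<^sup>-\<^sup>1) q\<^sub>i/2\<close>.
  The excess \<open>tr(V\<^sup>-\<^sup>1) q\<^sub>i/2\<close> is the derivative of \<open>q\<^sub>i/2 \<cdot> \<Sum> log(A + D\<^sub>k)\<close>, which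
  accounts for the product in the formula.\<close>

lemma h_ols_iff:
  fixes X :: "real^'p^'m"
  assumes rank: "rank X = CARD('p)" and D: "\<And>j. D $ j > 0"
  shows "is_h_ols X D z i h \<longleftrightarrow>
    (\<exists>C>0. \<forall>A>0. h A = C * A powr (1/4 * (1 + z\<^sup>2)) * (A + D $ i) powr (1/4 * (7 - z\<^sup>2))
       * (\<Prod>k\<in>UNIV. A + D $ k) powr (1/2 * leverage X i)
       * exp (- (1/2) * tr_Vinv D A * (X $ i \<bullet> (var_ols X D A *v X $ i))))"
proof -
  let ?q = "\<lambda>A. X $ i \<bullet> (var_ols X D A *v X $ i)" and ?l = "leverage X i"
  let ?G = "\<lambda>A. 1/2 * ?l * (\<Sum>k\<in>UNIV. ln (A + D $ k)) - 1/2 * (tr_Vinv D A * ?q A)"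
  have pos: "A + D $ j > 0" if "A > 0" for A j
    using D[of j] that by simp
  have nz: "A + D $ j \<noteq> 0" if "A > 0" for A j
    using pos[OF that, of j] by simp
  have "(?G has_real_derivative 1/2 * tr_Vinv2 D A * ?q A) (at A)" if A: "A > 0" for A
  proof -
    have "((\<lambda>A. \<Sum>k\<in>UNIV. ln (A + D $ k)) has_real_derivative tr_Vinv D A) (at A)"
      using pos[OF A] by (auto intro!: derivative_eq_intros simp: tr_Vinv_eq)
    moreover have "((\<lambda>A. tr_Vinv D A * ?q A) has_real_derivative
        - tr_Vinv2 D A * ?q A + tr_Vinv D A * ?l) (at A)"
      using DERIV_mult[OF has_real_derivative_tr_Vinv[OF D A] has_real_derivative_var_ols_form[OF rank]]
      by (simp add: algebra_simps)
    ultimately have "(?G has_real_derivative 1/2 * ?l * tr_Vinv D A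
        - 1/2 * (- tr_Vinv2 D A * ?q A + tr_Vinv D A * ?l)) (at A)"
      by (intro DERIV_diff DERIV_cmult)
    then show ?thesis
      by (rule back_subst[where P="\<lambda>D'. (?G has_real_derivative D') (at A)"])
        (simp add: algebra_simps)
  qed
  note factor = adjustment_factor_iff[OF D this, where z = z and h = h]
  have "exp (?G A) = (\<Prod>k\<in>UNIV. A + D $ k) powr (1/2 * ?l) * exp (- (1/2) * tr_Vinv D A * ?q A)"
    if "A > 0" for A
  proof -
    have "(\<Prod>k\<in>UNIV. A + D $ k) > 0" "ln (\<Prod>k\<in>UNIV. A + D $ k) = (\<Sum>k\<in>UNIV. ln (A + D $ k))"
      using pos[OF that] nz[OF that] by (simp_all add: prod_pos ln_prod)
    then show ?thesis
      using nz[OF that] by (simp add: powr_def mult.assoc flip: exp_add)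
  qed
  then have "A powr (1/4 * (1 + z\<^sup>2)) * (A + D $ i) powr (1/4 * (7 - z\<^sup>2)) * exp (?G A)
      = A powr (1/4 * (1 + z\<^sup>2)) * (A + D $ i) powr (1/4 * (7 - z\<^sup>2))
       * (\<Prod>k\<in>UNIV. A + D $ k) powr (1/2 * ?l) * exp (- (1/2) * tr_Vinv D A * ?q A)"
    if "A > 0" for A
    using that by (simp only: mult.assoc)
  from positive_multiple_cong[OF this, where h = h] factor show ?thesis
    by (simp only: mult.assoc)
qed

section \<open>The balanced case\<close>

lemma balanced_fh_V:
  assumes "\<And>j. D $ j = d"
  shows "fh_V D A = (A + d) *\<^sub>R mat 1"
  by (simp add: fh_V_eq assms diagonal_matrix_const)

lemma balanced_fh_V_inverse:
  assumes "\<And>j. D $ j = d" "A + d > 0"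
  shows "matrix_inv (fh_V D A) = (1 / (A + d)) *\<^sub>R mat 1"
  by (subst fh_V_inverse) (simp_all add: assms diagonal_matrix_const)

lemma balanced_var_gls:
  fixes X :: "real^'p^'m"
  assumes "rank X = CARD('p)" "\<And>j. D $ j = d" "A + d > 0"
  shows "var_gls X D A = (A + d) *\<^sub>R matrix_inv (transpose X ** X)"
  using assms(3)
  by (simp add: var_gls_def balanced_fh_V_inverse[OF assms(2,3)] matrix_scalar_ac
      matrix_inv_scaleR[OF _ invertible_gram[OF assms(1)]] flip: scalar_matrix_assoc)

lemma balanced_var_ols:
  fixes X :: "real^'p^'m"
  assumes "rank X = CARD('p)" "\<And>j. D $ j = d"
  shows "var_ols X D A = (A + d) *\<^sub>R matrix_inv (transpose X ** X)"
  by (simp add: var_ols_def balanced_fh_V[OF assms(2)] matrix_scalar_ac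
      gram_inverse_sandwich[OF assms(1)] flip: scalar_matrix_assoc)

text \<open>Here \<open>tr(V\<^sup>-\<^sup>2) = m/(A + d)\<^sup>2\<close> and the quadratic form is \<open>(A + d)q\<^sub>i\<close>, so the integrand
  is \<open>m q\<^sub>i/(2(A + d))\<close> and merely raises the exponent of \<open>A + d\<close>.\<close>

lemma balanced_adjustment_factor_iff:
  fixes X :: "real^'p^'m"
  assumes D: "\<And>j. D $ j = d" and d: "d > 0"
    and S: "\<And>A. A > 0 \<Longrightarrow> S A = (A + d) *\<^sub>R matrix_inv (transpose X ** X)"
  shows "is_adjustment_factor X D z S i h \<longleftrightarrow>
    (\<exists>C>0. \<forall>A>0. h A = C * A powr (1/4 * (1 + z\<^sup>2))
       * (A + d) powr (1/4 * (7 - z\<^sup>2) + 1/2 * real CARD('m) * leverage X i))"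
proof -
  let ?e = "1/2 * real CARD('m) * leverage X i"
  have Dpos: "D $ j > 0" for j by (simp add: D d)
  have "((\<lambda>A. ?e * ln (A + d)) has_real_derivative
      1/2 * tr_Vinv2 D A * (X $ i \<bullet> (S A *v X $ i))) (at A)" if "A > 0" for A
  proof -
    have "1/2 * tr_Vinv2 D A * (X $ i \<bullet> (S A *v X $ i)) = ?e / (A + d)"
      using that d
      by (subst tr_Vinv2_eq)
        (simp_all add: D S leverage_def power2_eq_square flip: scaleR_matrix_vector_assoc)
    then show ?thesis
      using that d by (auto intro!: derivative_eq_intros)
  qed
  note factor = adjustment_factor_iff[OF Dpos this, where z = z and h = h]
  have "(A + d) powr (1/4 * (7 - z\<^sup>2)) * exp (?e * ln (A + d))
      = (A + d) powr (1/4 * (7 - z\<^sup>2) + ?e)" if "A > 0" for A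
    using that d by (simp add: powr_def exp_add distrib_right)
  then have "A powr (1/4 * (1 + z\<^sup>2)) * (A + D $ i) powr (1/4 * (7 - z\<^sup>2)) * exp (?e * ln (A + d))
      = A powr (1/4 * (1 + z\<^sup>2)) * (A + d) powr (1/4 * (7 - z\<^sup>2) + ?e)" if "A > 0" for A
    using that by (simp only: mult.assoc D)
  from positive_multiple_cong[OF this, where h = h] factor show ?thesis
    by (simp only: mult.assoc D)
qed

text \<open>With \<open>V = (A + d)I\<close> the two determinants contribute \<open>(A + d)\<^sup>p\<^sup>/\<^sup>2\<close> and
  \<open>(A + d)\<^sup>-\<^sup>m\<^sup>/\<^sup>2\<close>, and \<open>P = (I - H)/(A + d)\<close> with the hat matrix \<open>H\<close>; the data
  enter only through the residual sum of squares \<open>s = y'(I - H)y\<close>.\<close>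

lemma balanced_residual_likelihood:
  fixes X :: "real^'p^'m" and y :: "real^'m"
  assumes rank: "rank X = CARD('p)" and D: "\<And>j. D $ j = d"
  obtains K s where "K > 0" and "\<And>A. A + d > 0 \<Longrightarrow> residual_likelihood X D y A =
    K * (A + d) powr (1/2 * (real CARD('p) - real CARD('m))) * exp (- s / (2 * (A + d)))"
proof
  let ?g = "transpose X ** X"
  let ?H = "X ** matrix_inv ?g ** transpose X"
  show "det ?g powr (- (1/2)) > 0"
    using invertible_gram[OF rank] by (simp add: invertible_det_nz)
  fix A assume A: "A + d > 0"
  have inv: "matrix_inv (fh_V D A) = (1 / (A + d)) *\<^sub>R mat 1"
    by (rule balanced_fh_V_inverse[OF D A])
  have detV: "det (fh_V D A) = (A + d) ^ CARD('m)"
    by (simp add: balanced_fh_V[OF D] det_scaleR)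
  have detW: "det (transpose X ** matrix_inv (fh_V D A) ** X) = (1 / (A + d)) ^ CARD('p) * det ?g"
    by (simp add: inv matrix_scalar_ac det_scaleR flip: scalar_matrix_assoc)
  have P: "fh_P X D A = (1 / (A + d)) *\<^sub>R (mat 1 - ?H)"
    using A by (simp add: fh_P_def inv Let_def matrix_scalar_ac scaleR_diff_right
        matrix_inv_scaleR[OF _ invertible_gram[OF rank]] flip: scalar_matrix_assoc)
  have "y \<bullet> (fh_P X D A *v y) = (y \<bullet> ((mat 1 - ?H) *v y)) / (A + d)"
    by (simp add: P flip: scaleR_matrix_vector_assoc)
  moreover have "((1 / (A + d)) ^ CARD('p) * det ?g) powr (- (1/2)) * ((A + d) ^ CARD('m)) powr (- (1/2))
    = det ?g powr (- (1/2)) * (A + d) powr (1/2 * (real CARD('p) - real CARD('m)))"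
    using A by (simp add: powr_mult powr_divide powr_powr powr_minus_divide diff_divide_distrib
        powr_diff flip: powr_realpow)
  ultimately show "residual_likelihood X D y A = det ?g powr (- (1/2))
      * (A + d) powr (1/2 * (real CARD('p) - real CARD('m)))
      * exp (- (y \<bullet> ((mat 1 - ?H) *v y)) / (2 * (A + d)))"
    by (simp add: residual_likelihood_def detV detW)
qed

text \<open>The derivative of \<open>log f\<close> is \<open>(e + bA - kA\<^sup>2)/(A(A + d)\<^sup>2)\<close> with \<open>k, e > 0\<close>. The roots
  of the numerator have the negative product \<open>- e/k\<close>, so exactly one of them, \<open>r\<close>, is positive, and
  the factorisation \<open>(r - A)(kA + e/r)\<close> shows that \<open>f\<close> increases before \<open>r\<close> and decreases after
  it.\<close>

lemma balanced_profile_unique_peak: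
  fixes a c d s :: real
  assumes a: "a > 0" and ac: "a + c < 0" and d: "d > 0"
  defines "f \<equiv> \<lambda>A. A powr a * (A + d) powr c * exp (- s / (2 * (A + d)))"
  obtains r where "r > 0" and "\<And>A. A > 0 \<Longrightarrow> A \<noteq> r \<Longrightarrow> f A < f r"
proof -
  define k b e where "k = - (a + c)" and "b = 2 * a * d + c * d + s / 2" and "e = a * d\<^sup>2"
  have k: "k > 0" and e: "e > 0" using assms by (auto simp: k_def e_def)
  \<comment> \<open>the positive root of \<open>k r\<^sup>2 - b r - e\<close>\<close>
  define r where "r = (b + sqrt (b\<^sup>2 + 4 * k * e)) / (2 * k)"
  have "sqrt (b\<^sup>2 + 4 * k * e) > \<bar>b\<bar>"
    using k e by (intro real_less_rsqrt) simp
  then have r: "r > 0" using k by (auto simp: r_def)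
  have "(2 * k * r - b)\<^sup>2 = b\<^sup>2 + 4 * k * e"
    using k e by (simp add: r_def)
  then have "4 * k * (k * r\<^sup>2 - b * r - e) = 0"
    by (simp add: power2_eq_square algebra_simps)
  then have root: "b * r = k * r\<^sup>2 - e" using k by simp
  define g where "g = (\<lambda>A. a * ln A + c * ln (A + d) - s / (2 * (A + d)))"
  have fg: "f A = exp (g A)" if "A > 0" for A
    using that d by (simp add: f_def g_def powr_def flip: exp_add)
  have g': "(g has_real_derivative (r - A) * ((k * A + e / r) / (A * (A + d)\<^sup>2))) (at A)"
    if A: "A > 0" for A
  proof -
    have "(g has_real_derivative a / A + c / (A + d) + s / (2 * (A + d)\<^sup>2)) (at A)"
    proof -
      have "((\<lambda>A. inverse (A + d)) has_real_derivative
          - (inverse (A + d) * 1 * inverse (A + d))) (at A)"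
        using A d by (intro DERIV_inverse') (auto intro!: derivative_eq_intros)
      moreover have "((\<lambda>A. ln (A + d)) has_real_derivative 1 / (A + d)) (at A)"
        using A d by (auto intro!: derivative_eq_intros)
      moreover have "(ln has_real_derivative 1 / A) (at A)"
        using A by (rule DERIV_ln_divide)
      ultimately have "((\<lambda>A. a * ln A + c * ln (A + d) - s / 2 * inverse (A + d)) has_real_derivative
          a * (1 / A) + c * (1 / (A + d)) - s / 2 * - (inverse (A + d) * 1 * inverse (A + d))) (at A)"
        by (intro DERIV_diff DERIV_add DERIV_cmult)
      then show ?thesis
        unfolding g_def by (simp add: power2_eq_square inverse_eq_divide)
    qed
    moreover have "a / A + c / (A + d) + s / (2 * (A + d)\<^sup>2) = (e + b * A - k * A\<^sup>2) / (A * (A + d)\<^sup>2)"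
      using A d by (simp add: divide_simps k_def b_def e_def) (simp add: algebra_simps power2_eq_square)
    moreover have "e + b * A - k * A\<^sup>2 = (r - A) * (k * A + e / r)"
    proof -
      have "b = k * r - e / r" using root r by (simp add: field_simps power2_eq_square)
      then show ?thesis using r by (simp only:) (simp add: field_simps power2_eq_square)
    qed
    ultimately show ?thesis by simp
  qed
  have pos: "(k * A + e / r) / (A * (A + d)\<^sup>2) > 0" if "A > 0" for A
    using that k e r d by (intro divide_pos_pos add_pos_pos mult_pos_pos) auto
  have cont: "continuous_on {u..v} g" if "u > 0" for u v
    by (rule DERIV_atLeastAtMost_imp_continuous_on, rule exI, rule g') (use that in simp)
  let ?g' = "\<lambda>t. (r - t) * ((k * t + e / r) / (t * (t + d)\<^sup>2))"
  have "g A < g r" if A: "A > 0" "A \<noteq> r" for A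
  proof (cases "A < r")
    case True
    show ?thesis
    proof (rule DERIV_pos_imp_increasing_open[OF True _ cont[OF A(1)]])
      fix t assume "A < t" "t < r"
      show "\<exists>y. (g has_real_derivative y) (at t) \<and> 0 < y"
      proof (intro exI conjI)
        show "(g has_real_derivative ?g' t) (at t)"
          by (rule g') (use A(1) \<open>A < t\<close> \<open>t < r\<close> in simp)
        show "0 < ?g' t"
          by (intro mult_pos_pos pos) (use A(1) \<open>A < t\<close> \<open>t < r\<close> in simp_all)
      qed
    qed
  next
    case False
    then have "r < A" using A by simp
    then show ?thesis
    proof (rule DERIV_neg_imp_decreasing_open[OF _ _ cont[OF r]])
      fix t assume "r < t" "t < A"
      show "\<exists>y. (g has_real_derivative y) (at t) \<and> y < 0"
      proof (intro exI conjI)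
        show "(g has_real_derivative ?g' t) (at t)"
          by (rule g') (use r \<open>r < t\<close> \<open>t < A\<close> in simp)
        show "?g' t < 0"
          by (intro mult_neg_pos pos) (use r \<open>r < t\<close> \<open>t < A\<close> in simp_all)
      qed
    qed
  qed
  then show thesis
    using r fg by (intro that[of r]) auto
qed

text \<open>The peak \<open>r\<close> of the profile does not depend on \<open>C\<close> or on \<open>h\<close>, so it serves the GLS and the
  OLS factor simultaneously. Continuity of \<open>h\<close> at the end point \<open>0\<close>, which the differential
  equation does not reach, forces \<open>h 0 = 0\<close>; otherwise the value at \<open>0\<close> could exceed the peak.\<close>

lemma balanced_estimate_unique:
  fixes X :: "real^'p^'m"
  assumes rank: "rank X = CARD('p)" and D: "\<And>j. D $ j = d" and d: "d > 0"
    and m: "leverage X i < 1" "real CARD('m) > (4 + real CARD('p)) / (1 - leverage X i)"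
  obtains r where "\<And>h C. C > 0 \<Longrightarrow> continuous_on {0..} h \<Longrightarrow>
      (\<And>A. A > 0 \<Longrightarrow> h A = C * A powr (1/4 * (1 + z\<^sup>2))
         * (A + d) powr (1/4 * (7 - z\<^sup>2) + 1/2 * real CARD('m) * leverage X i)) \<Longrightarrow>
      adj_reml_estimates X D h y = {r}"
proof -
  define a b where "a = 1/4 * (1 + z\<^sup>2)"
    and "b = 1/4 * (7 - z\<^sup>2) + 1/2 * real CARD('m) * leverage X i"
  let ?c = "b + 1/2 * (real CARD('p) - real CARD('m))"
  have "real CARD('m) * (1 - leverage X i) > 4 + real CARD('p)"
    using m by (simp add: field_simps)
  then have ac: "a + ?c < 0"
    by (simp add: a_def b_def algebra_simps)
  have a: "a > 0" unfolding a_def by (simp add: add_pos_nonneg)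
  obtain K s where K: "K > 0" and L: "\<And>A. A + d > 0 \<Longrightarrow> residual_likelihood X D y A =
    K * (A + d) powr (1/2 * (real CARD('p) - real CARD('m))) * exp (- s / (2 * (A + d)))"
    using balanced_residual_likelihood[OF rank D] by blast
  let ?f = "\<lambda>A. A powr a * (A + d) powr ?c * exp (- s / (2 * (A + d)))"
  obtain r where r: "r > 0" and peak: "\<And>A. A > 0 \<Longrightarrow> A \<noteq> r \<Longrightarrow> ?f A < ?f r"
    using balanced_profile_unique_peak[OF a ac d, of s] by blast
  show thesis
  proof (rule that[of r])
    fix h C assume C: "C > 0" and cont: "continuous_on {0..} h"
      and h: "\<And>A. A > 0 \<Longrightarrow> h A = C * A powr (1/4 * (1 + z\<^sup>2))
         * (A + d) powr (1/4 * (7 - z\<^sup>2) + 1/2 * real CARD('m) * leverage X i)"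
    note h' = h[folded a_def b_def]
    have "(h \<longlongrightarrow> h 0) (at_right 0)"
      using cont by (auto simp: continuous_on_def intro: tendsto_within_subset)
    moreover have "(h \<longlongrightarrow> 0) (at_right 0)"
    proof -
      have "((\<lambda>A. C * A powr a * (A + d) powr b) \<longlongrightarrow> C * 0 powr a * (0 + d) powr b) (at_right 0)"
        using a d
        by (intro tendsto_intros tendsto_powr2) (auto simp: eventually_at_filter)
      then have "((\<lambda>A. C * A powr a * (A + d) powr b) \<longlongrightarrow> 0) (at_right 0)"
        by simp
      then show ?thesis
        by (rule Lim_transform_eventually) (simp add: h' eventually_at_filter)
    qed
    ultimately have h0: "h 0 = 0"
      using tendsto_unique trivial_limit_at_right_real by blast
    let ?J = "\<lambda>t. h t * residual_likelihood X D y t"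
    have J: "?J A = C * K * ?f A" if "A > 0" for A
      using that d L[of A] h'[of A] by (simp add: powr_add mult_ac)
    have less: "?J A < ?J r" if "A \<ge> 0" "A \<noteq> r" for A
    proof (cases "A = 0")
      case True
      then show ?thesis using h0 J[OF r] C K r d by simp
    next
      case False
      then show ?thesis
        using J[of A] J[OF r] peak[of A] C K that by simp
    qed
    have "is_arg_max ?J (\<lambda>t. t \<in> {0..}) A \<longleftrightarrow> A = r" for A
    proof
      assume "is_arg_max ?J (\<lambda>t. t \<in> {0..}) A"
      then have "A \<ge> 0" "\<not> ?J A < ?J r"
        using r by (auto simp: is_arg_max_def)
      then show "A = r" using less[of A] by blast
    next
      assume "A = r"
      moreover have "\<not> ?J r < ?J t" if "t \<ge> 0" for t
        using less[OF that] by (cases "t = r") auto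
      ultimately show "is_arg_max ?J (\<lambda>t. t \<in> {0..}) A"
        using r by (simp add: is_arg_max_def)
    qed
    then show "adj_reml_estimates X D h y = {r}"
      by (simp add: adj_reml_estimates_def)
  qed
qed

section \<open>Adjustment factors and estimates\<close>

theorem theorem2:
  fixes X :: "real^'p^'m" and D :: "real^'m" and \<alpha> z :: real and i :: 'm
  assumes "CARD('p) < CARD('m)"
    and "rank X = CARD('p)"
    and "\<And>j. D $ j > 0"
    and "0 < \<alpha>" and "\<alpha> < 1"
    and "cdf std_normal_distribution z = 1 - \<alpha> / 2"
  shows
    "(\<exists>G. \<forall>A>0. (G has_real_derivative
                  1/2 * tr_Vinv2 D A * (X $ i \<bullet> (var_gls X D A *v X $ i))) (at A))
     \<and>
     (\<forall>G. (\<forall>A>0. (G has_real_derivative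
                  1/2 * tr_Vinv2 D A * (X $ i \<bullet> (var_gls X D A *v X $ i))) (at A)) \<longrightarrow>
       (\<forall>h. is_h_gls X D z i h \<longleftrightarrow>
         (\<exists>C>0. \<forall>A>0. h A = C * A powr (1/4 * (1 + z^2)) * (A + D $ i) powr (1/4 * (7 - z^2))
                            * exp (G A))))
     \<and>
     (\<forall>h. is_h_ols X D z i h \<longleftrightarrow>
       (\<exists>C>0. \<forall>A>0. h A = C * A powr (1/4 * (1 + z^2)) * (A + D $ i) powr (1/4 * (7 - z^2))
                          * (\<Prod>k\<in>UNIV. A + D $ k) powr (1/2 * leverage X i)
                          * exp (- (1/2) * tr_Vinv D A * (X $ i \<bullet> (var_ols X D A *v X $ i)))))
     \<and>
     (\<forall>d. (\<forall>j. D $ j = d) \<longrightarrow>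
       (\<forall>h. is_h_gls X D z i h \<longleftrightarrow>
         (\<exists>C>0. \<forall>A>0. h A = C * A powr (1/4 * (1 + z^2))
                            * (A + d) powr (1/4 * (7 - z^2) + 1/2 * real CARD('m) * leverage X i)))
       \<and>
       (\<forall>h. is_h_ols X D z i h \<longleftrightarrow>
         (\<exists>C>0. \<forall>A>0. h A = C * A powr (1/4 * (1 + z^2))
                            * (A + d) powr (1/4 * (7 - z^2) + 1/2 * real CARD('m) * leverage X i)))
       \<and>
       (leverage X i < 1 \<and> real CARD('m) > (4 + real CARD('p)) / (1 - leverage X i) \<longrightarrow>
         (\<forall>hg ho y.
           is_h_gls X D z i hg \<and> continuous_on {0..} hg \<and>
           is_h_ols X D z i ho \<and> continuous_on {0..} ho \<longrightarrow>
           (\<exists>Ahat. adj_reml_estimates X D hg y = {Ahat} \<and> adj_reml_estimates X D ho y = {Ahat}))))"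
proof (intro conjI)
  show "\<exists>G. \<forall>A>0. (G has_real_derivative
      1/2 * tr_Vinv2 D A * (X $ i \<bullet> (var_gls X D A *v X $ i))) (at A)"
    by (rule var_gls_antiderivative_exists) fact+
next
  show "\<forall>G. (\<forall>A>0. (G has_real_derivative
          1/2 * tr_Vinv2 D A * (X $ i \<bullet> (var_gls X D A *v X $ i))) (at A)) \<longrightarrow>
       (\<forall>h. is_h_gls X D z i h \<longleftrightarrow>
         (\<exists>C>0. \<forall>A>0. h A = C * A powr (1/4 * (1 + z^2)) * (A + D $ i) powr (1/4 * (7 - z^2))
                            * exp (G A)))"
    using adjustment_factor_iff[OF assms(3)] by blast
next
  show "\<forall>h. is_h_ols X D z i h \<longleftrightarrow>
       (\<exists>C>0. \<forall>A>0. h A = C * A powr (1/4 * (1 + z^2)) * (A + D $ i) powr (1/4 * (7 - z^2))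
                          * (\<Prod>k\<in>UNIV. A + D $ k) powr (1/2 * leverage X i)
                          * exp (- (1/2) * tr_Vinv D A * (X $ i \<bullet> (var_ols X D A *v X $ i))))"
    using h_ols_iff[OF assms(2,3)] by blast
next
  let ?form = "\<lambda>d h. \<exists>C>0. \<forall>A>0. h A = C * A powr (1/4 * (1 + z^2))
      * (A + d) powr (1/4 * (7 - z^2) + 1/2 * real CARD('m) * leverage X i)"
  show "\<forall>d. (\<forall>j. D $ j = d) \<longrightarrow>
       (\<forall>h. is_h_gls X D z i h \<longleftrightarrow> ?form d h) \<and>
       (\<forall>h. is_h_ols X D z i h \<longleftrightarrow> ?form d h) \<and>
       (leverage X i < 1 \<and> real CARD('m) > (4 + real CARD('p)) / (1 - leverage X i) \<longrightarrow>
         (\<forall>hg ho y.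
           is_h_gls X D z i hg \<and> continuous_on {0..} hg \<and>
           is_h_ols X D z i ho \<and> continuous_on {0..} ho \<longrightarrow>
           (\<exists>Ahat. adj_reml_estimates X D hg y = {Ahat} \<and> adj_reml_estimates X D ho y = {Ahat})))"
  proof (rule allI, rule impI)
    fix d assume "\<forall>j. D $ j = d"
    then have D: "D $ j = d" for j by simp
    have d: "d > 0" using assms(3) D by metis
    have gls: "is_h_gls X D z i h \<longleftrightarrow> ?form d h" for h
      using d by (intro balanced_adjustment_factor_iff balanced_var_gls assms(2) D) simp_all
    have ols: "is_h_ols X D z i h \<longleftrightarrow> ?form d h" for h
      by (intro balanced_adjustment_factor_iff balanced_var_ols assms(2) D d)
    have estimate: "\<exists>Ahat. adj_reml_estimates X D hg y = {Ahat} \<and> adj_reml_estimates X D ho y = {Ahat}"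
      if m: "leverage X i < 1" "real CARD('m) > (4 + real CARD('p)) / (1 - leverage X i)"
        and hg: "?form d hg" "continuous_on {0..} hg"
        and ho: "?form d ho" "continuous_on {0..} ho" for hg ho y
    proof -
      obtain r where r: "\<And>h C. C > 0 \<Longrightarrow> continuous_on {0..} h \<Longrightarrow>
          (\<And>A. A > 0 \<Longrightarrow> h A = C * A powr (1/4 * (1 + z\<^sup>2))
             * (A + d) powr (1/4 * (7 - z\<^sup>2) + 1/2 * real CARD('m) * leverage X i)) \<Longrightarrow>
          adj_reml_estimates X D h y = {r}"
        using balanced_estimate_unique[OF assms(2) D d m, where z = z and y = y] by metis
      have "adj_reml_estimates X D h y = {r}" if "?form d h" "continuous_on {0..} h" for h
        using that r by blast
      then show ?thesis using hg ho by blast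
    qed
    show "(\<forall>h. is_h_gls X D z i h \<longleftrightarrow> ?form d h) \<and>
       (\<forall>h. is_h_ols X D z i h \<longleftrightarrow> ?form d h) \<and>
       (leverage X i < 1 \<and> real CARD('m) > (4 + real CARD('p)) / (1 - leverage X i) \<longrightarrow>
         (\<forall>hg ho y.
           is_h_gls X D z i hg \<and> continuous_on {0..} hg \<and>
           is_h_ols X D z i ho \<and> continuous_on {0..} ho \<longrightarrow>
           (\<exists>Ahat. adj_reml_estimates X D hg y = {Ahat} \<and> adj_reml_estimates X D ho y = {Ahat})))"
      unfolding gls ols using estimate by blast
  qed
qed

end
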